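(* For every integer $n\geq 23$, there is a $\tfrac{7}{4}^+$-free circular word of length $n$ over an alphabet of $3$ letters.
   Context: A word $w=w_1\cdots w_n$ has period $p\ge 1$ if $w_{i+p}=w_i$ for all $1\le i\le n-p$ (so $n$ is always a period). The exponent of a nonempty word is its length divided by its minimal period. Two words $x,y$ are conjugates if $x=uv$ and $y=vu$ for some words $u,v$. For a word $w$, the circular word $(w)$ is the set of all conjugates of $w$; its length is $|w|$. A word is a factor of $(w)$ if it is a (contiguous) factor of some conjugate of $w$. A (linear or circular) word is $\beta^+$-free if it has no factor of exponent strictly greater than $\beta$. *)

theory Defs
  imports Complex_Main "HOL-Library.Sublist"
begin

definition has_period :: "'a list \<Rightarrow> nat \<Rightarrow> bool" where
  "has_period w p \<longleftrightarrow> p \<ge> 1 \<and> (\<forall>i. i + p < length w \<longrightarrow> w ! (i + p) = w ! i)"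

definition min_period :: "'a list \<Rightarrow> nat" where
  "min_period w = (LEAST p. has_period w p)"

lemma has_period_length: "w \<noteq> [] \<Longrightarrow> has_period w (length w)"
  by (cases w) (auto simp: has_period_def)

lemma has_period_min_period: "w \<noteq> [] \<Longrightarrow> has_period w (min_period w)"
  unfolding min_period_def by (rule LeastI) (rule has_period_length)

text \<open>Only meaningful for nonempty words.\<close>
definition exponent :: "'a list \<Rightarrow> real" where
  "exponent w = real (length w) / real (min_period w)"

definition conjugates :: "'a list \<Rightarrow> 'a list \<Rightarrow> bool" where
  "conjugates x y \<longleftrightarrow> (\<exists>u v. x = u @ v \<and> y = v @ u)"

definition circular_word :: "'a list \<Rightarrow> 'a list set" where
  "circular_word w = {y. conjugates w y}"

text \<open>The contiguous factors of a word are its \<^const>\<open>sublist\<close>s. A factor of a circular word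
  lies inside a single conjugate, so it is at most as long as the circular word.\<close>
definition circular_factor :: "'a list \<Rightarrow> 'a list set \<Rightarrow> bool" where
  "circular_factor x C \<longleftrightarrow> (\<exists>y\<in>C. sublist x y)"

text \<open>For a circular word \<open>C\<close>, this is \<open>\<beta>\<^sup>+\<close>-freeness: exponent exactly \<open>\<beta>\<close> is allowed.\<close>
definition circular_plus_free :: "real \<Rightarrow> 'a list set \<Rightarrow> bool" where
  "circular_plus_free \<beta> C \<longleftrightarrow>
     \<not> (\<exists>x. x \<noteq> [] \<and> circular_factor x C \<and> exponent x > \<beta>)"

end

theory Submission
  imports Defs
begin

text \<open>
  Call a word \<open>w\<close> strongly free if, in the periodic bi-infinite continuation of \<open>w\<close>, two equal
  blocks of length \<open>r\<close> at a distance \<open>0 < p < |w|\<close> satisfy \<open>4 r \<le> 3 p\<close>. This implies that the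
  circular word \<open>(w)\<close> is \<open>7/4\<^sup>+\<close>-free, and it makes the repetitions wrapping around \<open>w\<close>
  behave like all others.

  Strongly free words are made longer as follows. In a strongly free word that starts with the first
  letter, replace that letter by a \<^emph>\<open>filler\<close> and every other letter by its image under Dejean's
  19-uniform morphism. A filler begins and ends like the Dejean image of the first letter, but the
  factors of length 18 in its interior are pairwise distinct and do not occur elsewhere. Hence two equal
  factors of length at least 18 contain a common block boundary, from which the repetition is read back
  as a repetition of the original word; its period only grows if the filler lies between the two
  occurrences, because fillers are longer than 19. The periods up to 22 are checked on triples of
  adjacent blocks. Fillers of the lengths 94, \<dots>, 150 turn the explicitly given words of length
  less than 132 into words of all larger lengths.
\<close>

section \<open>Words and their evaluation\<close>

datatype letter = L0 | L1 | L2

fun letters :: "string \<Rightarrow> letter list" where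
  "letters [] = []"
| "letters (ch # s) = (if ch = CHR ''a'' then L0 else if ch = CHR ''b'' then L1 else L2) # letters s"

text \<open>
  The counter \<open>k\<close> starts at \<open>s\<close> and loses 4 with each match, so that a run of \<open>r\<close> matches
  is accepted iff \<open>4 r \<le> s\<close>. For the period \<open>p\<close> the bound is \<open>s = 3 p\<close>, which
  grows by 3 from one period to the next.
\<close>

fun no_long_run :: "nat \<Rightarrow> nat \<Rightarrow> 'a list \<Rightarrow> 'a list \<Rightarrow> bool" where
  "no_long_run s k (x # xs) (y # ys) =
    (if x = y then 4 \<le> k \<and> no_long_run s (k - 4) xs ys else no_long_run s s xs ys)"
| "no_long_run s k [] ys = True"
| "no_long_run s k (x # xs) [] = True"

fun short_periods :: "nat \<Rightarrow> nat \<Rightarrow> 'a list \<Rightarrow> 'a list \<Rightarrow> bool" where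
  "short_periods (Suc c) s xs (y # ys) =
    (no_long_run (Suc (Suc (Suc s))) (Suc (Suc (Suc s))) xs ys \<and> short_periods c (Suc (Suc (Suc s))) xs ys)"
| "short_periods 0 s xs ys = True"
| "short_periods (Suc c) s xs [] = True"

fun all_shifts :: "nat \<Rightarrow> 'a list \<Rightarrow> 'a list \<Rightarrow> bool" where
  "all_shifts s xs (y # ys) = (no_long_run s s xs ys \<and> all_shifts s xs ys)"
| "all_shifts s xs [] = True"

fun half_length :: "'a list \<Rightarrow> nat" where
  "half_length (x # y # xs) = Suc (half_length xs)"
| "half_length [x] = 0"
| "half_length [] = 0"

text \<open>
  Tries of words of length 18, labelled with the distance from the start of the word to the next block
  boundary. Insertion needs no correctness proof, since synchronization only uses that \<open>decode\<close>
  is a function and its values on the relevant words, which are evaluated.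
\<close>

datatype tree = No | At nat | Ask tree tree tree

fun insert_window :: "nat \<Rightarrow> letter list \<Rightarrow> nat \<Rightarrow> tree \<Rightarrow> tree" where
  "insert_window (Suc k) (L0 # v) d (Ask r s t) = Ask (insert_window k v d r) s t"
| "insert_window (Suc k) (L1 # v) d (Ask r s t) = Ask r (insert_window k v d s) t"
| "insert_window (Suc k) (L2 # v) d (Ask r s t) = Ask r s (insert_window k v d t)"
| "insert_window (Suc k) (L0 # v) d No = Ask (insert_window k v d No) No No"
| "insert_window (Suc k) (L1 # v) d No = Ask No (insert_window k v d No) No"
| "insert_window (Suc k) (L2 # v) d No = Ask No No (insert_window k v d No)"
| "insert_window k v d t = At d"

text \<open>The first letter is dropped before a window is read. Hence with the counter 19 the
  windows at the offsets 1 to 19 receive the labels 18 down to 0.\<close>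

fun insert_windows :: "nat \<Rightarrow> letter list \<Rightarrow> tree \<Rightarrow> tree" where
  "insert_windows (Suc d) (x # u) t = insert_windows d u (insert_window 18 u d t)"
| "insert_windows d u t = t"

fun decode :: "nat \<Rightarrow> tree \<Rightarrow> letter list \<Rightarrow> nat option" where
  "decode (Suc k) (Ask r s t) (L0 # v) = decode k r v"
| "decode (Suc k) (Ask r s t) (L1 # v) = decode k s v"
| "decode (Suc k) (Ask r s t) (L2 # v) = decode k t v"
| "decode k (At d) v = Some d"
| "decode k _ v = None"

fun decodes_windows :: "tree \<Rightarrow> nat \<Rightarrow> letter list \<Rightarrow> bool" where
  "decodes_windows t (Suc d) (x # u) = (decode 18 t u = Some d \<and> decodes_windows t d u)"
| "decodes_windows t d u = True"

text \<open>Of the second list only the length counts: it bounds the offsets tested, which again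
  start at 1.\<close>

fun undecoded :: "tree \<Rightarrow> letter list \<Rightarrow> 'a list \<Rightarrow> bool" where
  "undecoded t (x # xs) (y # ys) = (decode 18 t xs = None \<and> undecoded t xs ys)"
| "undecoded t xs ys = True"

section \<open>Dejean's morphism, the fillers and the explicit words\<close>

fun dejean :: "letter \<Rightarrow> letter list" where
  "dejean L0 = letters ''abcacbcabcbacbcacba''"
| "dejean L1 = letters ''bcabacabcacbacabacb''"
| "dejean L2 = letters ''cabcbabcabacbabcbac''"

definition filler_prefix :: "letter list" where
  "filler_prefix = letters ''abcacbcabcbacbcabacbabcabacabcacbabcba''"

definition filler_suffix :: "letter list" where
  "filler_suffix = letters ''abcbabcacbacabacbabcabacbcabcbacbcacba''"

text \<open>
  The middle parts of the fillers, found by backtracking search. The common prefix and suffix have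
  length 38, so that a repetition of period at most 22, which has at most 39 relevant letters, cannot
  reach from outside a filler into its middle part.
\<close>

definition fillers :: "string list" where
  "fillers = [''cabacbcacbabcbacbc'', ''cabacbcacbacabcacbc'', ''cabacbcacbacabcbacbc'',
    ''cabacbabcabacabcbacbc'', ''cabacbabcacbacabcbacbc'', ''cabacbcacbacabcacbcabac'',
    ''cabacbcabcbacabcacbcabac'', ''cabacbabcacbacabcacbcabac'', ''cabacbabcacbacabcbacbcabac'',
    ''cabacbcacbacabcacbabcabacbc'', ''cabacbcabcbacabcacbabcabacbc'', ''cbcacbacabcacbabcabacabcbacbc'',
    ''cbcabcbacabacbabcacbacabcbacbc'', ''cabacbabcacbacabacbcacbabcbacbc'',
    ''cabacbabcacbacabacbcacbabcabacbc'', ''cabacbabcabacabcbabcacbacabcbacbc'',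
    ''cabacbabcacbacabcacbcabacbabcbacbc'', ''cabacbcacbacabcbacbcabcbabcacbcabac'',
    ''cabacbabcabacabcbacbcabcbabcacbcabac'', ''cabacbabcabacabcbacbcacbacabcacbcabac'',
    ''cabacbabcacbacabcacbcabacabcbabcabacbc'', ''cabacbabcabacabcbacbcabcbabcabacabcacbc'',
    ''cabacbabcabacabcbacbcacbacabcacbabcbacbc'', ''cabacbabcabacabcbabcacbcabcbacabcacbcabac'',
    ''cabacbabcacbacabacbcacbabcbacabcacbabcabac'', ''cabacbabcabacabcbacbcacbabcbacabcacbabcabac'',
    ''cabacbabcabacabcbacbcabcbabcacbacabcacbcabac'', ''cabacbabcabacabcbabcacbacabcacbcabacbabcbacbc'',
    ''cabacbabcabacabcbacbcacbacabcacbcabacbabcbacbc'', ''cabacbabcabacabcbabcacbcabcbacabacbcacbabcbacbc'',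
    ''cabacbabcabacabcbabcacbcabacabcbacbcacbacabcacbc'',
    ''cabacbabcabacabcbabcacbacabcacbcabacabcbabcabacbc'',
    ''cabacbabcabacabcbacbcabcbabcabacbcacbacabcacbcabac'',
    ''cabacbabcabacabcbabcacbcabcbacabcacbabcabacabcbacbc'',
    ''cabacbabcabacabcbabcacbcabcbacabacbcacbacabcacbcabac'',
    ''cabacbabcabacabcbabcacbacabcacbcabacbabcacbacabcbacbc'',
    ''cabacbabcabacabcbabcacbcabcbacabcacbcabacabcbabcabacbc'',
    ''cabacbabcabacabcbacbcacbacabcacbabcbacbcabcbabcacbcabac'',
    ''cabacbabcabacabcbabcacbacabcacbcabcbacabacbcacbabcabacbc'',
    ''cabacbabcabacabcbabcacbacabcacbcabcbacabacbcacbacabcbacbc'',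
    ''cabacbabcabacabcbacbcacbabcbacabcacbabcabacbcacbacabcbacbc'',
    ''cbcabacbabcacbcabacabcbacbcacbabcbacabacbcacbacabcbacbcabac'',
    ''cbcabacbabcacbcabacabcbacbcacbacabcacbcabacbabcacbacabcbacbc'',
    ''cbcabacbabcacbcabacabcbacbcacbacabcacbabcbacabacbcacbabcbacbc'',
    ''cbcabacbabcacbcabacabcbacbcacbacabacbabcbacbcabcbacabcacbcabac'',
    ''cbcabacbabcacbcabacabcbacbcacbacabacbabcbacbcabcbacabacbabcabac'',
    ''cbcabacbabcacbcabacabcbacbcacbacabacbabcbacbcabcbacabcacbabcabac'',
    ''cbcabacbabcacbcabacabcbacbcacbacabcacbabcbacabacbabcacbacabcbacbc'',
    ''cbcabacbabcacbcabacabcbacbcacbacabacbabcbacbcabcbacabcacbabcabacbc'',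
    ''cbcabacbabcacbcabacabcbacbcacbacabcacbabcbacabacbcabcbacabcacbcabac'',
    ''cbcabacbabcacbcabacabcbacbcacbacabacbabcbacbcabcbacabacbcacbabcbacbc'',
    ''cbcabacbabcacbcabacabcbacbcacbacabacbabcbacbcabcbacabacbcacbabcabacbc'',
    ''cbcabacbabcacbcabacabcbacbcacbacabacbabcbacbcabcbacabacbcacbacabcbacbc'',
    ''cbcabacbabcacbcabacabcbacbcacbacabacbabcbacbcabcbacabacbabcabacabcbacbc'',
    ''cbcabacbabcacbcabacabcbacbcacbacabacbabcbacbcabcbacabacbabcacbacabcbacbc'',
    ''cbcabacbabcacbcabacabcbacbcacbacabacbabcbacbcabcbacabacbcacbacabcacbcabac'',
    ''cbcabacbabcacbcabacabcbacbcacbacabacbabcbacbcabcbacabacbcacbacabcbacbcabac'']"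

definition seeds :: "string list" where
  "seeds = [''abc'', ''abacbc'', ''abacbabc'', ''abacabcacbc'', ''abacabcacbabc'', ''abacabcbabcacbc'',
    ''abacabcacbabcbacbc'', ''abacabcacbacabacbabc'', ''abacabcacbacabcbabcacbc'',
    ''abacabcacbabcbacabacbabc'', ''abacabcacbabcabacabcbacbc'', ''abacabcacbabcabacbabcbacbc'',
    ''abacabcacbacabcbacbcabcbabc'', ''abacabcacbabcabacabcbabcacbc'', ''abacabcacbabcbacabacbcabcbabc'',
    ''abacabcacbabcabacbcabcbabcacbc'', ''abacabcacbabcabacbcacbacabcbabc'',
    ''abacabcacbabcabacbcacbacabcbacbc'', ''abacabcacbabcabacbabcbacbcabcbabc'',
    ''abacabcacbabcbacabacbcacbacabcbabc'', ''abacabcacbabcabacbcacbacabcbabcacbc'',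
    ''abacabcacbabcabacabcbabcacbcabcbacbc'', ''abacabcacbabcabacabcbabcacbacabcbacbc'',
    ''abacabcacbabcabacbabcbacabcacbabcbacbc'', ''abacabcacbabcabacbabcbacabcacbcabcbacbc'',
    ''abacabcacbabcabacbcacbabcbacabacbabcacbc'', ''abacabcacbabcabacabcbabcacbacabacbabcacbc'',
    ''abacabcacbabcabacabcbabcacbacabacbabcbacbc'', ''abacabcacbabcabacabcbacbcacbacabacbabcbacbc'',
    ''abacabcacbabcabacabcbabcacbacabcacbcabcbacbc'', ''abacabcacbabcabacabcbacbcabacbabcacbcabcbacbc'',
    ''abacabcacbabcabacabcbabcacbacabacbcabcbabcacbc'', ''abacabcacbabcabacabcbabcacbcabcbacabacbabcbacbc'',
    ''abacabcacbabcabacabcbabcacbacabcbacbcabcbabcacbc'',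
    ''abacabcacbabcabacabcbabcacbacabacbabcabacabcbacbc'',
    ''abacabcacbabcabacabcbacbcabacbabcbacabcacbabcbacbc'',
    ''abacabcacbabcabacabcbabcacbcabcbacabacbcabcbabcacbc'',
    ''abacabcacbabcabacabcbabcacbacabcbacbcabacabcbabcacbc'',
    ''abacabcacbabcabacabcbabcacbacabacbabcbacbcabcbabcacbc'',
    ''abacabcacbabcabacabcbabcacbacabacbabcabacbcabcbabcacbc'',
    ''abacabcacbabcabacabcbabcacbacabacbabcbacabcacbcabcbacbc'',
    ''abacabcacbabcabacabcbabcacbacabacbabcabacabcacbcabcbacbc'',
    ''abacabcacbabcabacabcbabcacbacabacbabcabacabcacbacabcbacbc'',
    ''abacabcacbabcabacabcbabcacbacabacbabcbacbcacbacabcbabcacbc'',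
    ''abacabcacbabcabacabcbabcacbacabacbabcabacbcacbacabcbabcacbc'',
    ''abacabcacbabcabacabcbabcacbacabacbabcabacabcacbacabcbabcacbc'',
    ''abacabcacbabcabacabcbabcacbacabacbabcabacabcacbcabacbabcbacbc'',
    ''abacabcacbabcabacabcbabcacbacabacbabcabacbcabcbabcabacabcbacbc'',
    ''abacabcacbabcabacabcbabcacbacabacbabcabacbcabcbabcacbacabcbacbc'',
    ''abacabcacbabcabacabcbabcacbacabacbabcabacbcacbabcbacabacbabcacbc'',
    ''abacabcacbabcabacabcbabcacbacabacbabcabacabcacbabcbacabacbabcacbc'',
    ''abacabcacbabcabacabcbabcacbacabacbabcabacabcacbabcbacbcabcbabcacbc'',
    ''abacabcacbabcabacabcbabcacbacabacbabcabacabcacbabcbacbcabacbabcacbc'',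
    ''abacabcacbabcabacabcbabcacbacabacbabcabacabcacbabcbacabcacbcabcbacbc'',
    ''abacabcacbabcabacabcbabcacbacabacbabcabacabcacbacabcbabcabacbabcbacbc'',
    ''abacabcacbabcabacabcbabcacbacabacbabcabacabcacbabcbacabacbcabcbabcacbc'',
    ''abacabcacbabcabacabcbabcacbacabacbabcabacabcacbabcbacbcacbacabcbabcacbc'',
    ''abacabcacbabcabacabcbabcacbacabacbabcabacabcacbabcbacabacbcacbacabcbacbc'',
    ''abacabcacbabcabacabcbabcacbacabacbabcabacabcacbabcbacabacbabcacbcabcbacbc'',
    ''abacabcacbabcabacabcbabcacbacabacbabcabacabcacbabcbacabacbabcacbacabcbacbc'',
    ''abacabcacbabcabacabcbabcacbacabacbabcabacabcacbabcbacabacbcacbacabcbabcacbc'',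
    ''abacabcacbabcabacabcbabcacbacabacbabcabacabcacbabcbacbcabacbabcacbacabcbacbc'',
    ''abacabcacbabcabacabcbabcacbacabacbabcabacabcacbabcbacabacbabcacbacabcbabcacbc'',
    ''abacabcacbabcabacabcbabcacbacabacbabcabacabcacbabcbacabacbabcabacbcabcbabcacbc'',
    ''abacabcacbabcabacabcbabcacbacabacbabcabacabcacbabcbacabacbcabcbabcabacbabcbacbc'',
    ''abacabcacbabcabacabcbabcacbacabacbabcabacabcacbabcbacabacbabcabacbcacbacabcbacbc'',
    ''abacabcacbabcabacabcbabcacbacabacbabcabacabcacbabcbacabacbabcacbacabcacbcabcbacbc'',
    ''abacabcacbabcabacabcbabcacbacabacbabcabacabcacbabcbacabacbcacbabcabacbcabcbabcacbc'',
    ''abacabcacbabcabacabcbabcacbacabacbabcabacabcacbabcbacabacbabcabacbcacbacabcbabcacbc'',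
    ''abacabcacbabcabacabcbabcacbacabacbabcabacabcacbabcbacabacbabcabacbcacbacabacbabcacbc'',
    ''abacabcacbabcabacabcbabcacbacabacbabcabacabcacbabcbacabacbabcabacbcabcbacabacbabcacbc'',
    ''abacabcacbabcabacabcbabcacbacabacbabcabacabcacbabcbacabacbabcabacbcabcbabcabacabcbacbc'',
    ''abacabcacbabcabacabcbabcacbacabacbabcabacabcacbabcbacabacbabcabacbcabcbabcacbacabcbacbc'',
    ''abacabcacbabcabacabcbabcacbacabacbabcabacabcacbabcbacabacbabcacbcabacabcbabcacbcabcbacbc'',
    ''abacabcacbabcabacabcbabcacbacabacbabcabacabcacbabcbacabacbabcabacbcacbabcbacbcabcbabcacbc'',
    ''abacabcacbabcabacabcbabcacbacabacbabcabacabcacbabcbacabacbabcabacbcabcbacabacbcacbabcbacbc'',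
    ''abacabcacbabcabacabcbabcacbacabacbabcabacabcacbabcbacabacbabcabacbcabcbabcacbacabacbabcacbc'',
    ''abacabcacbabcabacabcbabcacbacabacbabcabacabcacbabcbacabacbabcabacbcabcbabcacbacabacbabcbacbc'',
    ''abacabcacbabcabacabcbabcacbacabacbabcabacabcacbabcbacabacbabcabacbcabcbabcabacabcacbcabcbacbc'',
    ''abacabcacbabcabacabcbabcacbacabacbabcabacabcacbabcbacabacbabcabacbcabcbabcabacabcacbacabcbacbc'',
    ''abacabcacbabcabacabcbabcacbacabacbabcabacabcacbabcbacabacbabcabacbcabcbacabacbcacbacabcbabcacbc'',
    ''abacabcacbabcabacabcbabcacbacabacbabcabacabcacbabcbacabacbabcabacbcabcbabcacbacabacbcacbabcbacbc'',
    ''abacabcacbabcabacabcbabcacbacabacbabcabacabcacbabcbacabacbabcabacbcabcbabcabacabcacbacabcbabcacbc'',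
    ''abacabcacbabcabacabcbabcacbacabacbabcabacabcacbabcbacabacbabcabacbcabcbabcabacabcacbacabacbabcacbc'',
    ''abacabcacbabcabacabcbabcacbacabacbabcabacabcacbabcbacabacbabcabacbcabcbabcabacabcacbacabacbabcbacbc'',
    ''abacabcacbabcabacabcbabcacbacabacbabcabacabcacbabcbacabacbabcabacbcabcbabcabacabcacbabcabacbabcbacbc'',
    ''abacabcacbabcabacabcbabcacbacabacbabcabacabcacbabcbacabacbabcabacbcabcbabcacbcabacabcbabcabacbabcacbc'',
    ''abacabcacbabcabacabcbabcacbacabacbabcabacabcacbabcbacabacbabcabacbcabcbabcabacabcbacbcacbacabcbabcacbc'',
    ''abacabcacbabcabacabcbabcacbacabacbabcabacabcacbabcbacabacbabcabacbcabcbabcabacabcacbabcbacbcabcbabcacbc'',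
    ''abacabcacbabcabacabcbabcacbacabacbabcabacabcacbabcbacabacbabcabacbcabcbabcabacabcacbabcabacbcacbabcbacbc'',
    ''abacabcacbabcabacabcbabcacbacabacbabcabacabcacbabcbacabacbabcabacbcabcbabcabacabcacbabcbacabcacbcabcbacbc'',
    ''abacabcacbabcabacabcbabcacbacabacbabcabacabcacbabcbacabacbabcabacbcabcbabcabacabcacbabcabacbcacbacabcbacbc'',
    ''abacabcacbabcabacabcbabcacbacabacbabcabacabcacbabcbacabacbabcabacbcabcbabcabacabcacbabcbacabacbcabcbabcacbc'',
    ''abacabcacbabcabacabcbabcacbacabacbabcabacabcacbabcbacabacbabcabacbcabcbabcabacabcacbabcbacbcacbacabcbabcacbc'',
    ''abacabcacbabcabacabcbabcacbacabacbabcabacabcacbabcbacabacbabcabacbcabcbabcabacabcacbabcabacbcacbacabcbabcacbc'',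
    ''abacabcacbabcabacabcbabcacbacabacbabcabacabcacbabcbacabacbabcabacbcabcbabcabacabcacbabcabacbcacbacabacbabcacbc'',
    ''abacabcacbabcabacabcbabcacbacabacbabcabacabcacbabcbacabacbabcabacbcabcbabcabacabcacbabcabacbabcbacbcabcbabcacbc'',
    ''abacabcacbabcabacabcbabcacbacabacbabcabacabcacbabcbacabacbabcabacbcabcbabcabacabcacbabcabacbabcbacabcacbabcbacbc'',
    ''abacabcacbabcabacabcbabcacbacabacbabcabacabcacbabcbacabacbabcabacbcabcbabcabacabcacbabcabacbabcbacabcacbcabcbacbc'',
    ''abacabcacbabcabacabcbabcacbacabacbabcabacabcacbabcbacabacbabcabacbcabcbabcabacabcacbabcabacbcacbabcbacabacbabcacbc'',
    ''abacabcacbabcabacabcbabcacbacabacbabcabacabcacbabcbacabacbabcabacbcabcbabcabacabcacbabcabacbabcbacabacbcabcbabcacbc'',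
    ''abacabcacbabcabacabcbabcacbacabacbabcabacabcacbabcbacabacbabcabacbcabcbabcabacabcacbabcabacbabcbacbcacbacabcbabcacbc'',
    ''abacabcacbabcabacabcbabcacbacabacbabcabacabcacbabcbacabacbabcabacbcabcbabcabacabcacbabcabacbabcbacabacbcacbacabcbacbc'',
    ''abacabcacbabcabacabcbabcacbacabacbabcabacabcacbabcbacabacbabcabacbcabcbabcabacabcacbabcabacbabcbacabcacbacabacbabcacbc'',
    ''abacabcacbabcabacabcbabcacbacabacbabcabacabcacbabcbacabacbabcabacbcabcbabcabacabcacbabcabacbabcbacabcacbacabacbabcbacbc'',
    ''abacabcacbabcabacabcbabcacbacabacbabcabacabcacbabcbacabacbabcabacbcabcbabcabacabcacbabcabacbabcbacabacbcacbacabcbabcacbc'',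
    ''abacabcacbabcabacabcbabcacbacabacbabcabacabcacbabcbacabacbabcabacbcabcbabcabacabcacbabcabacbcabcbacabacbcacbacabcbabcacbc'',
    ''abacabcacbabcabacabcbabcacbacabacbabcabacabcacbabcbacabacbabcabacbcabcbabcabacabcacbabcabacbabcbacabacbcacbabcabacabcbacbc'',
    ''abacabcacbabcabacabcbabcacbacabacbabcabacabcacbabcbacabacbabcabacbcabcbabcabacabcacbabcabacbabcbacabacbcabcbabcabacabcbacbc'',
    ''abacabcacbabcabacabcbabcacbacabacbabcabacabcacbabcbacabacbabcabacbcabcbabcabacabcacbabcabacbabcbacabacbcabcbabcabacbabcbacbc'',
    ''abacabcacbabcabacabcbabcacbacabacbabcabacabcacbabcbacabacbabcabacbcabcbabcabacabcacbabcabacbabcbacabcacbabcbacbcacbacabcbacbc'',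
    ''abacabcacbabcabacabcbabcacbacabacbabcabacabcacbabcbacabacbabcabacbcabcbabcabacabcacbabcabacbabcbacabacbcacbabcbacbcabcbabcacbc'',
    ''abacabcacbabcabacabcbabcacbacabacbabcabacabcacbabcbacabacbabcabacbcabcbabcabacabcacbabcabacbabcbacabacbcacbabcabacbcabcbabcacbc'',
    ''abacabcacbabcabacabcbabcacbacabacbabcabacabcacbabcbacabacbabcabacbcabcbabcabacabcacbabcabacbabcbacabacbcabcbabcabacbcacbabcbacbc'',
    ''abacabcacbabcabacabcbabcacbacabacbabcabacabcacbabcbacabacbabcabacbcabcbabcabacabcacbabcabacbabcbacabacbcabcbabcacbacabacbabcbacbc'',
    ''abacabcacbabcabacabcbabcacbacabacbabcabacabcacbabcbacabacbabcabacbcabcbabcabacabcacbabcabacbabcbacabacbcabcbabcabacabcacbcabcbacbc'',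
    ''abacabcacbabcabacabcbabcacbacabacbabcabacabcacbabcbacabacbabcabacbcabcbabcabacabcacbabcabacbabcbacabacbcabcbabcabacabcacbacabcbacbc'']"

text \<open>These are the 19 letters on each side of any boundary that can occur. Adjacent letters
  differ and a filler stands for \<open>L0\<close>, so the neighbours of a filler are images of
  \<open>L1\<close> or \<open>L2\<close>.\<close>

definition boundary_words :: "letter list list" where
  "boundary_words =
    [dejean L0 @ dejean L1, dejean L0 @ dejean L2, dejean L1 @ dejean L0, dejean L1 @ dejean L2,
     dejean L2 @ dejean L0, dejean L2 @ dejean L1,
     dejean L1 @ take 19 filler_prefix, dejean L2 @ take 19 filler_prefix,
     drop 19 filler_suffix @ dejean L1, drop 19 filler_suffix @ dejean L2]"

definition window_tree :: tree where
  "window_tree = fold (insert_windows 19) boundary_words No"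

text \<open>With these rules evaluation is pure pattern matching, without conditionals or
  arithmetic. No rule matches equal letters at a counter below 4, so a violated bound leaves the
  goal unproved.\<close>

lemma no_long_run_rules:
  "no_long_run s (Suc (Suc (Suc (Suc k)))) (L0 # xs) (L0 # ys) = no_long_run s k xs ys"
  "no_long_run s (Suc (Suc (Suc (Suc k)))) (L1 # xs) (L1 # ys) = no_long_run s k xs ys"
  "no_long_run s (Suc (Suc (Suc (Suc k)))) (L2 # xs) (L2 # ys) = no_long_run s k xs ys"
  "no_long_run s k (L0 # xs) (L1 # ys) = no_long_run s s xs ys"
  "no_long_run s k (L0 # xs) (L2 # ys) = no_long_run s s xs ys"
  "no_long_run s k (L1 # xs) (L0 # ys) = no_long_run s s xs ys"
  "no_long_run s k (L1 # xs) (L2 # ys) = no_long_run s s xs ys"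
  "no_long_run s k (L2 # xs) (L0 # ys) = no_long_run s s xs ys"
  "no_long_run s k (L2 # xs) (L1 # ys) = no_long_run s s xs ys"
  "no_long_run s k [] ys = True"
  "no_long_run s k xs [] = True"
  by (simp_all add: eval_nat_numeral) (cases xs; simp)

lemma letters_rules:
  "letters [] = []"
  "letters (CHR ''a'' # s) = L0 # letters s"
  "letters (CHR ''b'' # s) = L1 # letters s"
  "letters (CHR ''c'' # s) = L2 # letters s"
  by simp_all

text \<open>
  As congruence rules these keep the simplifier from traversing the long lists again after each step.
  The arguments have to be evaluated beforehand, for which \<open>filler_check\<close> and \<open>period_check\<close>
  below are introduced.
\<close>

lemma weak_congs:
  "no_long_run s k xs ys = no_long_run s k xs ys"
  "short_periods c s xs ys = short_periods c s xs ys"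
  "all_shifts s xs ys = all_shifts s xs ys"
  "undecoded t xs zs = undecoded t xs zs"
  "decode k t u = decode k t u"
  "letters v = letters v"
  by (rule refl)+

lemmas unary = numeral_eq_Suc pred_numeral_simps BitM.simps

definition filler_check :: "nat \<Rightarrow> nat \<Rightarrow> tree \<Rightarrow> letter list \<Rightarrow> letter list \<Rightarrow> bool" where
  "filler_check c s t B B' \<longleftrightarrow> short_periods c 0 B B \<and> all_shifts s B B \<and> undecoded t B B'"

text \<open>The bound 68 = 4 * 17 makes factors of length 18 at distinct offsets of \<open>B\<close>
  different. Dropping 19 letters restricts \<open>undecoded\<close> to the windows containing
  neither the first nor the last letter of \<open>B\<close>; all others touch a block
  boundary.\<close>

definition good_filler :: "letter list \<Rightarrow> bool" where
  "good_filler B \<longleftrightarrow> filler_check 22 68 window_tree B (drop 19 B)"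

definition period_check :: "nat \<Rightarrow> letter list \<Rightarrow> bool" where
  "period_check c v \<longleftrightarrow> short_periods c 0 v v"

text \<open>Periods up to half the length suffice, since on the circle a distance \<open>p\<close>
  is also the distance \<open>length w - p\<close> in the other direction.\<close>

definition good_seed :: "letter list \<Rightarrow> bool" where
  "good_seed w \<longleftrightarrow> period_check (half_length w) (w @ w) \<and> hd w = L0"

section \<open>Soundness of the checks\<close>

text \<open>The case distinction makes the induction work: a run at the front continues one already
  being counted, for which only \<open>k\<close> is left, while a later run is measured against the
  full budget \<open>s\<close>.\<close>

lemma no_long_runD:
  assumes "no_long_run s k xs ys" "k \<le> s" "i + r \<le> length xs" "i + r \<le> length ys"
    "\<And>j. j < r \<Longrightarrow> xs ! (i + j) = ys ! (i + j)"
  shows "4 * r \<le> (if i = 0 then k else s)"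
  using assms
proof (induction s k xs ys arbitrary: i r rule: no_long_run.induct)
  case (1 s k x xs y ys)
  show ?case
  proof (cases i)
    case 0
    show ?thesis
    proof (cases r)
      case (Suc r')
      have "x = y" using 1(7)[of 0] 0 Suc by simp
      have "4 * r' \<le> (if (0::nat) = 0 then k - 4 else s)"
      proof (rule 1(1)[OF \<open>x = y\<close>])
        show "xs ! (0 + j) = ys ! (0 + j)" if "j < r'" for j
          using 1(7)[of "Suc j"] 0 Suc that by simp
      qed (use 1 0 Suc \<open>x = y\<close> in auto)
      moreover have "4 \<le> k" using 1(3) \<open>x = y\<close> by simp
      ultimately show ?thesis using 0 Suc by simp
    qed simp
  next
    case (Suc i')
    have eq: "xs ! (i' + j) = ys ! (i' + j)" if "j < r" for j
      using 1(7)[OF that] Suc by simp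
    show ?thesis
    proof (cases "x = y")
      case True
      have "4 * r \<le> (if i' = 0 then k - 4 else s)"
        by (rule 1(1)[OF True]) (use 1 Suc True eq in auto)
      then show ?thesis using 1(4) Suc by (auto split: if_splits)
    next
      case False
      have "4 * r \<le> (if i' = 0 then s else s)"
        by (rule 1(2)[OF False]) (use 1 Suc False eq in auto)
      then show ?thesis using Suc by simp
    qed
  qed
qed auto

lemma no_long_run_bound:
  assumes "no_long_run s s xs ys" "i + r \<le> length xs" "i + r \<le> length ys"
    "\<And>j. j < r \<Longrightarrow> xs ! (i + j) = ys ! (i + j)"
  shows "4 * r \<le> s"
  using no_long_runD[OF assms(1) le_refl assms(2,3,4)] by (simp split: if_splits)

text \<open>Each letter dropped from \<open>ys\<close> raises the distance by 1 and the budget by 3,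
  so \<open>s\<close> has to stay general here; the checks start it at 0.\<close>

lemma short_periodsD:
  assumes "short_periods c s xs ys" "1 \<le> p" "p \<le> c" "i + r \<le> length xs" "i + p + r \<le> length ys"
    "\<And>j. j < r \<Longrightarrow> xs ! (i + j) = ys ! (i + p + j)"
  shows "4 * r \<le> s + 3 * p"
  using assms
proof (induction c s xs ys arbitrary: p rule: short_periods.induct)
  case (1 c s xs y ys)
  show ?case
  proof (cases "p = 1")
    case True
    have "4 * r \<le> Suc (Suc (Suc s))"
      by (rule no_long_run_bound[of _ xs ys i]) (use 1 True in auto)
    then show ?thesis using True by simp
  next
    case False
    then obtain q where q: "p = Suc q" "1 \<le> q" using 1(3) by (cases p) auto
    have "4 * r \<le> Suc (Suc (Suc s)) + 3 * q"
      by (rule 1(1)) (use 1 q in auto)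
    then show ?thesis using q by simp
  qed
qed auto

lemma all_shiftsD:
  assumes "all_shifts s xs ys" "1 \<le> p" "i + r \<le> length xs" "i + p + r \<le> length ys"
    "\<And>j. j < r \<Longrightarrow> xs ! (i + j) = ys ! (i + p + j)"
  shows "4 * r \<le> s"
  using assms
proof (induction s xs ys arbitrary: p rule: all_shifts.induct)
  case (1 s xs y ys)
  show ?case
  proof (cases "p = 1")
    case True
    show ?thesis
      by (rule no_long_run_bound[of _ xs ys i]) (use 1 True in auto)
  next
    case False
    then obtain q where q: "p = Suc q" "1 \<le> q" using 1(3) by (cases p) auto
    show ?thesis
      by (rule 1(1)) (use 1 q in auto)
  qed
qed auto

text \<open>A trie inspects at most \<open>k\<close> letters, so a window may be replaced by the
  whole suffix that starts with it.\<close>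

lemma decode_take: "decode k t (take k v) = decode k t v"
  by (induction k t v rule: decode.induct) simp_all

lemma decodes_windowsD:
  assumes "decodes_windows t d u" "1 \<le> i" "i \<le> d" "i \<le> length u"
  shows "decode 18 t (drop i u) = Some (d - i)"
  using assms
proof (induction t d u arbitrary: i rule: decodes_windows.induct)
  case (1 t d x u)
  then show ?case by (cases "i = 1"; cases i) auto
qed auto

lemma undecodedD:
  assumes "undecoded t xs ys" "1 \<le> i" "i \<le> length xs" "i \<le> length ys"
  shows "decode 18 t (drop i xs) = None"
  using assms
proof (induction t xs ys arbitrary: i rule: undecoded.induct)
  case (1 t x xs y ys)
  then show ?case by (cases "i = 1"; cases i) auto
qed auto

lemma half_length: "half_length xs = length xs div 2"
  by (induction xs rule: half_length.induct) auto

section \<open>Circular words\<close>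

definition cyc :: "'a list \<Rightarrow> nat \<Rightarrow> 'a" where
  "cyc w i = w ! (i mod length w)"

definition strongly_free :: "'a list \<Rightarrow> bool" where
  "strongly_free w \<longleftrightarrow> (\<forall>p i r. 0 < p \<longrightarrow> p < length w \<longrightarrow>
     (\<forall>j<r. cyc w (i + j) = cyc w (i + p + j)) \<longrightarrow> 4 * r \<le> 3 * p)"

lemma cyc_add_length [simp]: "cyc w (i + length w) = cyc w i"
  by (simp add: cyc_def)

lemma cyc_conjugate:
  assumes "k < length (v @ u)"
  shows "(v @ u) ! k = cyc (u @ v) (length u + k)"
proof (cases "k < length v")
  case True
  then show ?thesis by (simp add: cyc_def nth_append)
next
  case False
  then have "length u + k = (k - length v) + (length u + length v)" by simp
  then have "(length u + k) mod (length u + length v) = (k - length v) mod (length u + length v)"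
    by (metis mod_add_self2)
  also have "\<dots> = k - length v" using assms by simp
  finally have "(length u + k) mod (length u + length v) = k - length v" .
  moreover have "k - length v < length u" using False assms by simp
  ultimately show ?thesis using False by (simp add: cyc_def nth_append)
qed

text \<open>A factor of length \<open>l\<close> and period \<open>p\<close> repeats a block of
  length \<open>l - p\<close> at distance \<open>p\<close>, and exponent above 7/4 means
  \<open>3 * p < 4 * (l - p)\<close>. Such a \<open>p\<close> is below \<open>l\<close> and hence
  below \<open>length w\<close>.\<close>

lemma strongly_free_imp_circular_plus_free:
  assumes "strongly_free w"
  shows "circular_plus_free (7/4) (circular_word w)"
  unfolding circular_plus_free_def
proof (intro notI, elim exE conjE)
  fix x assume x: "x \<noteq> []" "circular_factor x (circular_word w)" "exponent x > 7/4"
  then obtain y where y: "conjugates w y" "sublist x y"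
    by (auto simp: circular_factor_def circular_word_def)
  from y(1) obtain u v where w: "w = u @ v" and "y = v @ u"
    by (auto simp: conjugates_def)
  with y(2) obtain ps ss where vu: "v @ u = ps @ x @ ss"
    by (auto simp: sublist_def)
  have len: "length ps + length x + length ss = length w"
    using arg_cong[OF vu, of length] w by simp
  have nth: "x ! j = cyc w (length u + length ps + j)" if "j < length x" for j
  proof -
    have "x ! j = (v @ u) ! (length ps + j)"
      using that by (simp add: vu nth_append)
    also have "\<dots> = cyc (u @ v) (length u + (length ps + j))"
      using that vu by (intro cyc_conjugate) simp
    finally show ?thesis by (simp add: w add.assoc)
  qed
  define p where "p = min_period x"
  have p: "has_period x p" unfolding p_def by (rule has_period_min_period[OF x(1)])
  then have "p \<ge> 1" by (simp add: has_period_def)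
  have "7 * p < 4 * length x"
    using x(3) \<open>p \<ge> 1\<close> by (simp add: exponent_def p_def[symmetric] field_simps)
  moreover have "4 * (length x - p) \<le> 3 * p"
  proof (rule assms[unfolded strongly_free_def, rule_format])
    show "0 < p" "p < length w" using \<open>p \<ge> 1\<close> \<open>7 * p < 4 * length x\<close> len by auto
    show "cyc w (length u + length ps + j) = cyc w (length u + length ps + p + j)"
      if "j < length x - p" for j
      using p that nth[of j] nth[of "j + p"] by (simp add: has_period_def ac_simps)
  qed
  ultimately show False by simp
qed

lemma strongly_free_map:
  assumes "strongly_free w" "inj g"
  shows "strongly_free (map g w)"
  unfolding strongly_free_def
proof (intro allI impI)
  fix p i r
  assume p: "0 < p" "p < length (map g w)"
    and run: "\<forall>j<r. cyc (map g w) (i + j) = cyc (map g w) (i + p + j)"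
  have "cyc (map g w) k = g (cyc w k)" for k
    using p by (auto simp: cyc_def intro!: nth_map mod_less_divisor)
  then have "\<forall>j<r. cyc w (i + j) = cyc w (i + p + j)"
    using run \<open>inj g\<close> by (auto dest: injD)
  then show "4 * r \<le> 3 * p"
    using assms(1) p by (auto simp: strongly_free_def)
qed

lemma good_seed_strongly_free:
  assumes "good_seed w"
  shows "strongly_free w"
proof -
  have half: "4 * r \<le> 3 * p"
    if p: "1 \<le> p" "2 * p \<le> length w" and run: "\<And>j. j < r \<Longrightarrow> cyc w (i + j) = cyc w (i + p + j)"
    for p i r
  proof (rule ccontr)
    assume neg: "\<not> 4 * r \<le> 3 * p"
    \<comment> \<open>The shortest forbidden run. It has at most \<open>p\<close> letters, so by
      \<open>2 * p \<le> length w\<close> both of its copies lie in \<open>w @ w\<close> when it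
      starts at \<open>i0 < length w\<close>.\<close>
    define r0 where "r0 = 3 * p div 4 + 1"
    have r0: "3 * p < 4 * r0" "r0 \<le> r" "r0 \<le> p" using neg p unfolding r0_def by auto
    define i0 where "i0 = i mod length w"
    have i0: "i0 < length w" unfolding i0_def by (rule mod_less_divisor) (use p in linarith)
    have ww: "(w @ w) ! k = cyc w k" if "k < 2 * length w" for k
      using that by (cases "k < length w") (simp_all add: cyc_def nth_append le_mod_geq)
    have mod: "cyc w (i0 + k) = cyc w (i + k)" for k
      by (simp add: cyc_def i0_def mod_add_left_eq)
    have "4 * r0 \<le> 0 + 3 * p"
    proof (rule short_periodsD)
      show "short_periods (half_length w) 0 (w @ w) (w @ w)"
        using assms by (simp add: good_seed_def period_check_def)
      show "(w @ w) ! (i0 + j) = (w @ w) ! (i0 + p + j)" if "j < r0" for j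
        using that run[of j] r0 p i0 ww[of "i0 + j"] ww[of "i0 + p + j"] mod[of j] mod[of "p + j"]
        by (simp add: add.assoc)
    qed (use p r0 i0 in \<open>auto simp: half_length\<close>)
    with r0 show False by simp
  qed
  show ?thesis
    unfolding strongly_free_def
  proof (intro allI impI)
    fix p i r
    assume p: "0 < p" "p < length w" and run: "\<forall>j<r. cyc w (i + j) = cyc w (i + p + j)"
    show "4 * r \<le> 3 * p"
    proof (cases "2 * p \<le> length w")
      case True
      then show ?thesis using half[of p r i] p run by simp
    next
      case False
      \<comment> \<open>The second block recurs as the first block one turn later, at the smaller
        distance \<open>length w - p\<close>.\<close>
      have "4 * r \<le> 3 * (length w - p)"
      proof (rule half)
        fix j assume "j < r"
        have "i + p + (length w - p) + j = i + j + length w" using p by simp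
        then show "cyc w (i + p + j) = cyc w (i + p + (length w - p) + j)"
          using run \<open>j < r\<close> by (metis cyc_add_length)
      qed (use p False in auto)
      then show ?thesis using False by simp
    qed
  qed
qed

section \<open>Evaluation of the finite checks\<close>

lemmas unary_recursions =
  insert_windows.simps [unfolded unary] decodes_windows.simps [unfolded unary] undecoded.simps [unfolded unary]

lemmas evaluation =
  no_long_run_rules short_periods.simps all_shifts.simps half_length.simps insert_window.simps
  decode.simps unary_recursions letters_rules filler_prefix_def filler_suffix_def dejean.simps
  boundary_words_def window_tree_def good_seed_def period_check_def good_filler_def filler_check_def
  list.sel list.map list.pred_inject append.simps drop_Suc_Cons drop_0 take_Suc_Cons take_0 fold_simps
  unary simp_thms option.inject option.distinct

lemma fillers_good:
  "list_all good_filler (map (\<lambda>s. filler_prefix @ letters s @ filler_suffix) fillers)"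
  by (simp only: fillers_def evaluation cong: weak_congs)

lemma seeds_good: "list_all good_seed (map letters seeds)"
  by (simp only: seeds_def evaluation cong: weak_congs)

lemma boundary_words_decoded: "list_all (decodes_windows window_tree 19) boundary_words"
  by (simp only: evaluation cong: weak_congs)

text \<open>This lemma, the next three and the check of the filler itself cover every stretch of 39
  letters. Three images have 57 = 18 + 39 letters, enough for any start in the first of
  them.\<close>

lemma dejean_words_free:
  assumes "x \<noteq> y" "y \<noteq> z"
  shows "short_periods 22 0 (dejean x @ dejean y @ dejean z) (dejean x @ dejean y @ dejean z)"
  unfolding period_check_def[symmetric] using assms
  by (cases x; cases y; cases z; simp only: evaluation cong: weak_congs)

lemma prefix_words_free:
  assumes "x \<noteq> y" "y \<noteq> L0"
  shows "short_periods 22 0 (dejean x @ dejean y @ filler_prefix) (dejean x @ dejean y @ filler_prefix)"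
  unfolding period_check_def[symmetric] using assms
  by (cases x; cases y; simp only: evaluation cong: weak_congs)

lemma prefix_word_free:
  assumes "y \<noteq> L0"
  shows "short_periods 22 0 (dejean y @ filler_prefix) (dejean y @ filler_prefix)"
  unfolding period_check_def[symmetric] using assms
  by (cases y; simp only: evaluation cong: weak_congs)

lemma suffix_words_free:
  assumes "x \<noteq> L0" "x \<noteq> y"
  shows "short_periods 22 0 (filler_suffix @ dejean x @ dejean y) (filler_suffix @ dejean x @ dejean y)"
  unfolding period_check_def[symmetric] using assms
  by (cases x; cases y; simp only: evaluation cong: weak_congs)

section \<open>Insertion of a filler\<close>

lemma length_dejean [simp]: "length (dejean x) = 19"
  by (cases x) simp_all

text \<open>Either end of an image reveals its letter, so agreement of two blocks in one end letter
  already yields equal letters of the original word.\<close>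

lemma dejean_first: "dejean x ! 0 = x" and dejean_last: "rev (dejean x) ! 0 = x"
  by (cases x; simp)+

lemma length_filler_prefix [simp]: "length filler_prefix = 38"
  and length_filler_suffix [simp]: "length filler_suffix = 38"
  by (simp_all add: filler_prefix_def filler_suffix_def)

text \<open>The filler agrees with \<open>dejean L0\<close> on 16 letters at either end and deviates
  at the 17th, still within the length 19 of an image.\<close>

lemma filler_prefix_first: "filler_prefix ! 0 = L0"
  and filler_prefix_deviates: "filler_prefix ! 16 \<noteq> dejean L0 ! 16"
  by (simp_all add: filler_prefix_def)

lemma filler_suffix_last: "rev filler_suffix ! 0 = L0"
  and filler_suffix_deviates: "rev filler_suffix ! 16 \<noteq> rev (dejean L0) ! 16"
  by (simp_all add: filler_suffix_def)

locale filler_insertion =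
  fixes w Z :: "letter list"
  assumes length_w: "3 \<le> length w"
    and free: "strongly_free w"
    and first: "cyc w 0 = L0"
    and filler: "good_filler (filler_prefix @ Z @ filler_suffix)"
begin

section \<open>Blocks of the extended word and their positions\<close>

definition B :: "letter list" where
  "B = filler_prefix @ Z @ filler_suffix"

text \<open>The index ranges over all naturals, which turns the periodic continuation into a
  sequence of blocks with a filler at each multiple of \<open>length w\<close>.\<close>

definition block :: "nat \<Rightarrow> letter list" where
  "block t = (if length w dvd t then B else dejean (cyc w t))"

definition start :: "nat \<Rightarrow> nat" where
  "start t = (\<Sum>k<t. length (block k))"

definition word :: "letter list" where
  "word = concat (map block [0..<length w])"

abbreviation c :: "nat \<Rightarrow> letter" where
  "c \<equiv> cyc word"

lemma length_B: "length B = length Z + 76"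
  by (simp add: B_def)

lemma B_first: "B ! 0 = L0" and B_last: "rev B ! 0 = L0"
  and B_prefix: "x < 38 \<Longrightarrow> B ! x = filler_prefix ! x"
  and B_suffix: "x < 38 \<Longrightarrow> rev B ! x = rev filler_suffix ! x"
  using filler_prefix_first filler_suffix_last by (auto simp: B_def nth_append)

lemma cyc_dvd: "length w dvd t \<Longrightarrow> cyc w t = L0"
  using first by (auto simp: cyc_def)

lemma adjacent: "cyc w t \<noteq> cyc w (Suc t)"
proof
  assume "cyc w t = cyc w (Suc t)"
  then have "4 * 1 \<le> 3 * (1::nat)"
    using free[unfolded strongly_free_def, rule_format, of 1 1 t] length_w by simp
  then show False by simp
qed

text \<open>As \<open>length w\<close> is at least 3, three consecutive blocks contain at most one
  filler.\<close>

lemma not_dvd: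
  assumes "length w dvd t"
  shows "\<not> length w dvd Suc t" "\<not> length w dvd Suc (Suc t)"
proof -
  show "\<not> length w dvd Suc t"
    using assms length_w dvd_add_right_iff[of "length w" t 1] by auto
  show "\<not> length w dvd Suc (Suc t)"
    using assms length_w dvd_add_right_iff[of "length w" t 2] by (auto dest: dvd_imp_le)
qed

lemma block_filler [simp]: "length w dvd t \<Longrightarrow> block t = B"
  and block_dejean [simp]: "\<not> length w dvd t \<Longrightarrow> block t = dejean (cyc w t)"
  by (simp_all add: block_def)

lemma block_period: "block (t + length w) = block t"
  by (simp add: block_def)

lemma length_block: "19 \<le> length (block t)"
  by (simp add: block_def length_B)

lemma block_first: "block t ! 0 = cyc w t" and block_last: "rev (block t) ! 0 = cyc w t"
  using B_first B_last by (cases "length w dvd t"; simp add: cyc_dvd dejean_first dejean_last)+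

lemma start_Suc: "start (Suc t) = start t + length (block t)"
  by (simp add: start_def)

lemma start_period: "start (t + length w) = start t + start (length w)"
proof (induction t)
  case (Suc t)
  then show ?case using start_Suc[of "t + length w"] start_Suc[of t] block_period[of t] by simp
qed (simp add: start_def)

lemma start_add: "start t + 19 * q \<le> start (t + q)"
proof (induction q)
  case (Suc q)
  then show ?case using length_block[of "t + q"] by (simp add: start_Suc)
qed simp

lemma start_less_iff: "start s < start t \<longleftrightarrow> s < t"
proof -
  have "strict_mono start"
    unfolding strict_mono_Suc_iff
  proof
    show "start n < start (Suc n)" for n using length_block[of n] by (simp only: start_Suc)
  qed
  then show ?thesis by (rule strict_mono_less)
qed

lemma length_concat_block: "length (concat (map block [0..<t])) = start t"
  by (simp add: length_concat start_def atLeast0LessThan[symmetric] interv_sum_list_conv_sum_set_nat o_def)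

lemma length_word: "length word = start (length w)"
  unfolding word_def by (rule length_concat_block)

lemma c_start:
  assumes "x < length (block t)"
  shows "c (start t + x) = block t ! x"
  using assms
proof (induction t rule: less_induct)
  case (less t)
  show ?case
  proof (cases "t < length w")
    case True
    then have "[0..<length w] = [0..<t] @ t # [Suc t..<length w]"
      using upt_add_eq_append[of 0 t "length w - t"] by (simp add: upt_conv_Cons)
    then have word: "word = concat (map block [0..<t]) @ block t @ concat (map block [Suc t..<length w])"
      by (simp add: word_def)
    moreover have "word ! (start t + x) = block t ! x"
      using less.prems by (simp add: word nth_append length_concat_block)
    moreover have "start t + x < length word"
      using less.prems by (simp add: word length_concat_block)
    ultimately show ?thesis by (simp add: cyc_def)
  next
    case False
    define s where "s = t - length w"
    have t: "t = s + length w" "s < t" using False length_w by (auto simp: s_def)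
    have "c (start t + x) = c (start s + x + length word)"
      by (simp add: t(1) start_period length_word ac_simps)
    also have "\<dots> = block t ! x"
      using less.IH[OF t(2)] less.prems by (simp add: t(1) block_period)
    finally show ?thesis .
  qed
qed

lemma c_start2:
  assumes "x < length (block t @ block (Suc t))"
  shows "c (start t + x) = (block t @ block (Suc t)) ! x"
proof (cases "x < length (block t)")
  case True
  then show ?thesis by (simp add: c_start nth_append)
next
  case False
  then show ?thesis
    using c_start[of "x - length (block t)" "Suc t"] assms by (simp add: start_Suc nth_append)
qed

lemma c_start3:
  assumes "x < length (block t @ block (Suc t) @ block (Suc (Suc t)))"
  shows "c (start t + x) = (block t @ block (Suc t) @ block (Suc (Suc t))) ! x"
proof (cases "x < length (block t)")
  case True
  then show ?thesis by (simp add: c_start nth_append)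
next
  case False
  then show ?thesis
    using c_start2[of "x - length (block t)" "Suc t"] assms by (simp add: start_Suc nth_append)
qed

lemma c_start_back:
  assumes "x < length (block t)"
  shows "c (start (Suc t) - Suc x) = rev (block t) ! x"
  using c_start[of "length (block t) - Suc x" t] assms by (simp add: start_Suc rev_nth)

lemma locate: "\<exists>t x. i = start t + x \<and> x < length (block t)"
proof (induction i)
  case 0
  show ?case using length_block[of 0] by (intro exI[of _ 0]) (auto simp: start_def)
next
  case (Suc i)
  then obtain t x where t: "i = start t + x" "x < length (block t)" by blast
  show ?case
  proof (cases "Suc x < length (block t)")
    case True
    with t show ?thesis by (intro exI[of _ t] exI[of _ "Suc x"]) simp
  next
    case False
    with t have "Suc i = start (Suc t) + 0" by (simp only: start_Suc)
    moreover have "0 < length (block (Suc t))" using length_block[of "Suc t"] by linarith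
    ultimately show ?thesis by blast
  qed
qed

section \<open>Repetitions of period at most 22\<close>

text \<open>A stretch of 39 letters from block \<open>t\<close> either lies in a filler or ends at
  the latest in block \<open>t + 2\<close>. The cases tell which of these blocks is a filler; a
  stretch entering or leaving a filler meets only its fixed prefix or suffix.\<close>

lemma local_word:
  "\<exists>U e. short_periods 22 0 U U \<and> e + 39 \<le> length U \<and> (\<forall>x<39. c (i + x) = U ! (e + x))"
proof -
  obtain t x where i: "i = start t + x" and x: "x < length (block t)" using locate by blast
  consider "length w dvd t" "x + 39 \<le> length B" | "length w dvd t" "length B < x + 39"
    | "length w dvd Suc t" | "length w dvd Suc (Suc t)"
    | "\<not> length w dvd t" "\<not> length w dvd Suc t" "\<not> length w dvd Suc (Suc t)"
    by linarith
  then show ?thesis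
  proof cases
    case 1
    have "c (i + y) = B ! (x + y)" if "y < 39" for y
      using 1 that c_start[of "x + y" t] by (simp add: i add.assoc)
    then show ?thesis
      using filler 1 by (intro exI[of _ B] exI[of _ x]) (simp add: good_filler_def filler_check_def B_def)
  next
    case 2
    let ?U = "filler_suffix @ dejean (cyc w (Suc t)) @ dejean (cyc w (Suc (Suc t)))"
    \<comment> \<open>A stretch leaving the filler starts among its last 38 letters;
      \<open>e\<close> is the offset in \<open>filler_suffix\<close>.\<close>
    have xB: "38 + length Z \<le> x" "x < length B" using 2 x by (auto simp: length_B)
    then obtain e where e: "x = 38 + length Z + e" "e < 38" by (auto simp: le_iff_add length_B)
    have "c (i + y) = ?U ! (e + y)" if "y < 39" for y
    proof -
      have "c (i + y) = (B @ dejean (cyc w (Suc t)) @ dejean (cyc w (Suc (Suc t)))) ! (x + y)"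
        using 2 that xB not_dvd[of t] c_start3[of "x + y" t] by (simp add: i add.assoc)
      also have "\<dots> = ?U ! (e + y)"
        using e that by (simp add: B_def nth_append)
      finally show ?thesis .
    qed
    moreover have "short_periods 22 0 ?U ?U"
      using adjacent[of t] adjacent[of "Suc t"] 2(1)
      by (intro suffix_words_free) (auto simp: cyc_dvd)
    ultimately show ?thesis
      using e by (intro exI[of _ ?U] exI[of _ e]) simp
  next
    case 3
    let ?U = "dejean (cyc w t) @ filler_prefix"
    have t: "\<not> length w dvd t" using 3 not_dvd(1) by blast
    have "c (i + y) = ?U ! (x + y)" if "y < 39" for y
      using that x t 3 c_start2[of "x + y" t] by (simp add: i add.assoc length_B nth_append B_prefix)
    moreover have "short_periods 22 0 ?U ?U"
      using adjacent[of t] 3 by (intro prefix_word_free) (auto simp: cyc_dvd)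
    ultimately show ?thesis
      using x t by (intro exI[of _ ?U] exI[of _ x]) simp
  next
    case 4
    let ?U = "dejean (cyc w t) @ dejean (cyc w (Suc t)) @ filler_prefix"
    have t: "\<not> length w dvd t" "\<not> length w dvd Suc t" using 4 not_dvd by blast+
    have "c (i + y) = ?U ! (x + y)" if "y < 39" for y
      using that x t 4 c_start3[of "x + y" t] by (simp add: i add.assoc length_B nth_append B_prefix)
    moreover have "short_periods 22 0 ?U ?U"
      using adjacent[of t] adjacent[of "Suc t"] 4 by (intro prefix_words_free) (auto simp: cyc_dvd)
    ultimately show ?thesis
      using x t by (intro exI[of _ ?U] exI[of _ x]) simp
  next
    case 5
    let ?U = "dejean (cyc w t) @ dejean (cyc w (Suc t)) @ dejean (cyc w (Suc (Suc t)))"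
    have "c (i + y) = ?U ! (x + y)" if "y < 39" for y
      using that x 5 c_start3[of "x + y" t] by (simp add: i add.assoc)
    moreover have "short_periods 22 0 ?U ?U"
      using adjacent[of t] adjacent[of "Suc t"] by (intro dejean_words_free)
    ultimately show ?thesis
      using x 5 by (intro exI[of _ ?U] exI[of _ x]) simp
  qed
qed

lemma short_period_bound:
  assumes "1 \<le> p" "p \<le> 22" and run: "\<And>j. j < r \<Longrightarrow> c (i + j) = c (i + p + j)"
  shows "4 * r \<le> 3 * p"
proof (rule ccontr)
  assume neg: "\<not> 4 * r \<le> 3 * p"
  \<comment> \<open>Cut to the shortest forbidden length, which is at most 17 for
    \<open>p \<le> 22\<close>, the run and its copy fit into 22 + 17 = 39 letters.\<close>
  define s where "s = 3 * p div 4 + 1"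
  have s: "3 * p < 4 * s" "s \<le> r" "p + s \<le> 39" using neg assms(2) by (auto simp: s_def)
  obtain U e where U: "short_periods 22 0 U U" "e + 39 \<le> length U" "\<forall>x<39. c (i + x) = U ! (e + x)"
    using local_word by blast
  have "4 * s \<le> 0 + 3 * p"
  proof (rule short_periodsD[OF U(1)])
    show "U ! (e + j) = U ! (e + p + j)" if "j < s" for j
      using that s run[of j] U(3)[rule_format, of j] U(3)[rule_format, of "p + j"]
      by (simp add: add.assoc)
  qed (use assms s U(2) in auto)
  with s show False by simp
qed

section \<open>Synchronization of equal windows\<close>

definition window :: "nat \<Rightarrow> letter list" where
  "window i = map (\<lambda>j. c (i + j)) [0..<18]"

lemma decode_window:
  assumes "\<And>j. j < 18 \<Longrightarrow> c (i + j) = U ! (e + j)" "e + 18 \<le> length U"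
  shows "decode 18 window_tree (window i) = decode 18 window_tree (drop e U)"
proof -
  have "window i = take 18 (drop e U)"
    using assms by (intro nth_equalityI) (auto simp: window_def)
  then show ?thesis by (simp add: decode_take)
qed

lemma decode_boundary_window:
  assumes "U \<in> set boundary_words" "\<And>j. j < 18 \<Longrightarrow> c (i + j) = U ! (e + j)" "1 \<le> e" "e \<le> 19"
  shows "decode 18 window_tree (window i) = Some (19 - e)"
proof -
  have U: "length U = 38" "decodes_windows window_tree 19 U"
    using assms(1) boundary_words_decoded by (auto simp: boundary_words_def list_all_iff)
  have "decode 18 window_tree (window i) = decode 18 window_tree (drop e U)"
    by (rule decode_window) (use assms U(1) in auto)
  also have "\<dots> = Some (19 - e)"
    by (rule decodes_windowsD) (use assms U in auto)
  finally show ?thesis .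
qed

text \<open>A window either touches a block boundary, and then the trie returns the distance to it,
  or lies strictly inside a filler and is not recognized.\<close>

lemma window_cases:
  assumes "1 \<le> i"
  obtains (boundary) d t where "d \<le> 18" "i + d = start t" "decode 18 window_tree (window i) = Some d"
  | (interior) t x where "length w dvd t" "i = start t + x" "1 \<le> x" "x + 19 \<le> length B"
      "decode 18 window_tree (window i) = None"
proof -
  \<comment> \<open>Locating \<open>i - 1\<close> yields an offset of at least 1. A window starting
    on a boundary is thus assigned to the block before it, where its label is 0.\<close>
  obtain t y where "i - 1 = start t + y" "y < length (block t)" using locate by blast
  then obtain x where i: "i = start t + x" and x: "1 \<le> x" "x \<le> length (block t)"
    using assms by (auto intro!: that[of "Suc y"])
  consider "length w dvd t" "x + 19 \<le> length B" | "length w dvd t" "length B < x + 19"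
    | "length w dvd Suc t" | "\<not> length w dvd t" "\<not> length w dvd Suc t"
    by linarith
  then show ?thesis
  proof cases
    case 1
    have "decode 18 window_tree (window i) = decode 18 window_tree (drop x B)"
      by (rule decode_window) (use 1 c_start[of "x + _" t] in \<open>auto simp: i add.assoc\<close>)
    also have "\<dots> = None"
      by (rule undecodedD[of _ _ "drop 19 B"])
        (use filler 1 x in \<open>auto simp: good_filler_def filler_check_def B_def\<close>)
    finally show ?thesis using interior 1 i x by blast
  next
    case 2
    let ?U = "drop 19 filler_suffix @ dejean (cyc w (Suc t))"
    have nt: "\<not> length w dvd Suc t" using not_dvd 2 by blast
    have xB: "length Z + 58 \<le> x" "x \<le> length B" using 2 x by (auto simp: length_B)
    \<comment> \<open>The last 19 letters of \<open>B\<close> begin at the offset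
      \<open>length Z + 57\<close> = 38 + \<open>length Z\<close> + 19.\<close>
    have "decode 18 window_tree (window i) = Some (19 - (x - (length Z + 57)))"
    proof (rule decode_boundary_window)
      have "cyc w (Suc t) \<noteq> L0" using adjacent[of t] 2 by (simp add: cyc_dvd)
      then show "?U \<in> set boundary_words"
        by (cases "cyc w (Suc t)") (simp_all add: boundary_words_def)
      show "c (i + j) = ?U ! (x - (length Z + 57) + j)" if "j < 18" for j
      proof -
        have "c (i + j) = (B @ dejean (cyc w (Suc t))) ! (x + j)"
          using that 2 xB nt c_start2[of "x + j" t] by (simp add: i add.assoc)
        also have "\<dots> = ?U ! (x - (length Z + 57) + j)"
          using xB that by (auto simp: B_def nth_append)
        finally show ?thesis .
      qed
    qed (use xB length_B in auto)
    moreover have "i + (19 - (x - (length Z + 57))) = start (Suc t)"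
      using 2 xB by (simp add: i start_Suc length_B)
    ultimately show ?thesis using xB by (intro boundary) auto
  next
    case 3
    let ?U = "dejean (cyc w t) @ take 19 filler_prefix"
    have nt: "\<not> length w dvd t" using 3 not_dvd(1) by blast
    have "decode 18 window_tree (window i) = Some (19 - x)"
    proof (rule decode_boundary_window)
      have "cyc w t \<noteq> L0" using adjacent[of t] 3 by (simp add: cyc_dvd)
      then show "?U \<in> set boundary_words"
        by (cases "cyc w t") (simp_all add: boundary_words_def)
      show "c (i + j) = ?U ! (x + j)" if "j < 18" for j
        using that x nt 3 c_start2[of "x + j" t]
        by (simp add: i add.assoc length_B nth_append B_prefix)
    qed (use x nt in auto)
    then show ?thesis using x nt by (intro boundary[of "19 - x" "Suc t"]) (auto simp: i start_Suc)
  next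
    case 4
    let ?U = "dejean (cyc w t) @ dejean (cyc w (Suc t))"
    have "decode 18 window_tree (window i) = Some (19 - x)"
    proof (rule decode_boundary_window)
      show "?U \<in> set boundary_words"
        using adjacent[of t]
        by (cases "cyc w t"; cases "cyc w (Suc t)") (simp_all add: boundary_words_def)
      show "c (i + j) = ?U ! (x + j)" if "j < 18" for j
        using that x 4 c_start2[of "x + j" t] by (simp add: i add.assoc)
    qed (use x 4 in auto)
    then show ?thesis using x 4 by (intro boundary[of "19 - x" "Suc t"]) (auto simp: i start_Suc)
  qed
qed

lemma not_both_dvd:
  assumes "t < t'" "t' < t + length w" "length w dvd t"
  shows "\<not> length w dvd t'"
proof
  assume "length w dvd t'"
  then have "length w dvd t' - t" using assms(3) by (rule dvd_diff_nat)
  then show False using assms(1,2) by (auto dest: dvd_imp_le)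
qed

text \<open>Equal windows decode alike, so both see a boundary at the same distance or both lie
  inside fillers. In the latter case their offsets coincide, and \<open>p\<close> would be the
  distance of two different fillers, which is at least \<open>length word\<close>.\<close>

lemma synchronization:
  assumes "1 \<le> i" "0 < p" "p < length word" and run: "\<And>j. j < 18 \<Longrightarrow> c (i + j) = c (i + p + j)"
  obtains d t t' where "d \<le> 18" "i + d = start t" "i + p + d = start t'"
proof -
  have eq: "window i = window (i + p)" using run by (simp add: window_def)
  show ?thesis
  proof (rule window_cases[OF assms(1)])
    fix d t assume d: "d \<le> 18" "i + d = start t" "decode 18 window_tree (window i) = Some d"
    show ?thesis
    proof (rule window_cases[of "i + p"])
      fix d' t' assume "d' \<le> 18" "i + p + d' = start t'" "decode 18 window_tree (window (i + p)) = Some d'"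
      then show ?thesis using d eq that by simp
    qed (use assms(1) d eq in auto)
  next
    fix t x assume t: "length w dvd t" "i = start t + x" "x + 19 \<le> length B"
      "decode 18 window_tree (window i) = None"
    show ?thesis
    proof (rule window_cases[of "i + p"])
      fix t' x' assume t': "length w dvd t'" "i + p = start t' + x'" "x' + 19 \<le> length B"
      have B: "all_shifts 68 B B" using filler by (simp add: good_filler_def filler_check_def B_def)
      have agree: "B ! (x + j) = B ! (x' + j)" if "j < 18" for j
      proof -
        have "B ! (x + j) = c (i + j)"
          using that t c_start[of "x + j" t] by (simp add: add.assoc)
        also have "\<dots> = c (i + p + j)" using run[OF that] .
        also have "i + p + j = start t' + (x' + j)" using t'(2) by simp
        also have "c \<dots> = B ! (x' + j)" using that t' c_start[of "x' + j" t'] by simp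
        finally show ?thesis .
      qed
      have "x = x'"
      proof (rule linorder_cases[of x x'])
        assume "x < x'"
        have "4 * 18 \<le> (68::nat)"
          by (rule all_shiftsD[OF B, of "x' - x" x]) (use \<open>x < x'\<close> agree t t' in auto)
        then show ?thesis by simp
      next
        assume "x' < x"
        have "4 * 18 \<le> (68::nat)"
          by (rule all_shiftsD[OF B, of "x - x'" x']) (use \<open>x' < x\<close> agree t t' in auto)
        then show ?thesis by simp
      qed
      then have "start t' = start t + p" using t t' by simp
      then have "start t < start t'" "start t' < start (t + length w)"
        using assms(2,3) by (auto simp: start_period length_word)
      then show ?thesis
        using not_both_dvd[of t t'] t t' by (simp add: start_less_iff)
    qed (use assms(1) t eq in auto)
  qed
qed

section \<open>Reading a repetition back in the original word\<close>

text \<open>Blocks fewer than \<open>length w\<close> indices apart are not both fillers, and a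
  filler differs from every image within 19 letters at either end.\<close>

lemma agree_imp_dejean:
  assumes "t < t'" "t' < t + length w"
    and "(\<forall>x<19. block t ! x = block t' ! x) \<or> (\<forall>x<19. rev (block t) ! x = rev (block t') ! x)"
  shows "\<not> length w dvd t \<and> \<not> length w dvd t'"
proof -
  have *: "\<not> ((\<forall>x<19. B ! x = dejean y ! x) \<or> (\<forall>x<19. rev B ! x = rev (dejean y) ! x))" for y
  proof
    assume "(\<forall>x<19. B ! x = dejean y ! x) \<or> (\<forall>x<19. rev B ! x = rev (dejean y) ! x)"
    then show False
    proof
      assume a: "\<forall>x<19. B ! x = dejean y ! x"
      have "y = L0" using a[rule_format, of 0] B_first dejean_first[of y] by simp
      then show False using a[rule_format, of 16] filler_prefix_deviates by (simp add: B_prefix)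
    next
      assume a: "\<forall>x<19. rev B ! x = rev (dejean y) ! x"
      have "y = L0" using a[rule_format, of 0] B_last dejean_last[of y] by simp
      then show False using a[rule_format, of 16] filler_suffix_deviates by (simp add: B_suffix)
    qed
  qed
  show ?thesis
    using *[of "cyc w t"] *[of "cyc w t'"] not_both_dvd[OF assms(1,2)] assms(3)
    by (cases "length w dvd t"; cases "length w dvd t'") auto
qed

text \<open>
  The filler counts as the first letter here. It can only be compared with a Dejean image, from
  which it deviates within 19 letters, so that it can only be the last block of an extension.
\<close>

lemma extend_right:
  assumes "t < t'" "t' < t + length w" "\<And>x. x < r \<Longrightarrow> c (start t + x) = c (start t' + x)"
  shows "\<exists>e. (\<forall>y<e. cyc w (t + y) = cyc w (t' + y)) \<and> r \<le> 19 * e"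
  using assms
proof (induction r arbitrary: t t' rule: less_induct)
  case (less r)
  have agree: "block t ! x = block t' ! x" if "x < r" "x < 19" for x
    using less.prems(3)[OF that(1)] that(2) length_block[of t] length_block[of t']
      c_start[of x t] c_start[of x t'] by simp
  consider "r = 0" | "0 < r" "r \<le> 19" | "19 < r" by linarith
  then show ?case
  proof cases
    case 2
    then have "cyc w t = cyc w t'" using agree[of 0] by (simp add: block_first)
    \<comment> \<open>A partly covered block counts as a whole letter, since its first letter
      determines it; only an upper bound on \<open>r\<close> is wanted.\<close>
    then show ?thesis using 2 by (intro exI[of _ 1]) simp
  next
    case 3
    then have letter: "cyc w t = cyc w t'" using agree[of 0] by (simp add: block_first)
    have nd: "\<not> length w dvd t" "\<not> length w dvd t'"
      using agree_imp_dejean[OF less.prems(1,2)] agree 3 by auto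
    have "\<exists>e. (\<forall>y<e. cyc w (Suc t + y) = cyc w (Suc t' + y)) \<and> r - 19 \<le> 19 * e"
    proof (rule less.IH)
      show "c (start (Suc t) + x) = c (start (Suc t') + x)" if "x < r - 19" for x
        using less.prems(3)[of "19 + x"] that nd by (simp add: start_Suc add.assoc)
    qed (use 3 less.prems in auto)
    then obtain e where e: "\<forall>y<e. cyc w (Suc t + y) = cyc w (Suc t' + y)" "r - 19 \<le> 19 * e" by blast
    have "cyc w (t + y) = cyc w (t' + y)" if "y < Suc e" for y
      using that e(1) letter by (cases y) auto
    then show ?thesis using e(2) by (intro exI[of _ "Suc e"]) simp
  qed auto
qed

text \<open>The mirror image of \<open>extend_right\<close>, counting backwards from the boundary.
  The bounds by \<open>start t\<close> and \<open>t\<close> keep the subtractions from being cut off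
  at 0.\<close>

lemma extend_left:
  assumes "t < t'" "t' < t + length w" "r \<le> start t"
    "\<And>x. x < r \<Longrightarrow> c (start t - Suc x) = c (start t' - Suc x)"
  shows "\<exists>e\<le>t. (\<forall>y<e. cyc w (t - Suc y) = cyc w (t' - Suc y)) \<and> r \<le> 19 * e"
  using assms
proof (induction r arbitrary: t t' rule: less_induct)
  case (less r)
  show ?case
  proof (cases "r = 0")
    case False
    then obtain s where s: "t = Suc s" using less.prems(3) by (cases t) (auto simp: start_def)
    then obtain s' where s': "t' = Suc s'" using less.prems(1) by (cases t') auto
    have st: "s < s'" "s' < s + length w" using less.prems s s' by auto
    have agree: "rev (block s) ! x = rev (block s') ! x" if "x < r" "x < 19" for x
      using less.prems(4)[OF that(1)] that(2) length_block[of s] length_block[of s']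
        c_start_back[of x s] c_start_back[of x s'] s s' by simp
    have letter: "cyc w s = cyc w s'" using agree[of 0] False by (simp add: block_last)
    show ?thesis
    proof (cases "r \<le> 19")
      case True
      then show ?thesis using letter s s' by (intro exI[of _ 1]) simp
    next
      case gt: False
      have nd: "\<not> length w dvd s" "\<not> length w dvd s'"
        using agree_imp_dejean[OF st] agree gt by auto
      have "\<exists>e\<le>s. (\<forall>y<e. cyc w (s - Suc y) = cyc w (s' - Suc y)) \<and> r - 19 \<le> 19 * e"
      proof (rule less.IH)
        show "r - 19 \<le> start s" using less.prems(3) nd by (simp add: s start_Suc)
        show "c (start s - Suc x) = c (start s' - Suc x)" if "x < r - 19" for x
          using less.prems(4)[of "19 + x"] that nd by (simp add: s s' start_Suc)
      qed (use gt st in auto)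
      then obtain e where e: "e \<le> s" "\<forall>y<e. cyc w (s - Suc y) = cyc w (s' - Suc y)" "r - 19 \<le> 19 * e"
        by blast
      have "cyc w (t - Suc y) = cyc w (t' - Suc y)" if "y < Suc e" for y
        using that e(2) letter s s' by (cases y) auto
      then show ?thesis using e s by (intro exI[of _ "Suc e"]) simp
    qed
  qed auto
qed

lemma strongly_free_word: "strongly_free word"
  unfolding strongly_free_def
proof (intro allI impI)
  fix p i0 r
  assume p: "0 < p" "p < length word" and run0: "\<forall>j<r. c (i0 + j) = c (i0 + p + j)"
  \<comment> \<open>One full turn makes the starting position positive, as
    \<open>synchronization\<close> demands.\<close>
  define i where "i = i0 + length word"
  have shift: "c (i + k) = c (i0 + k)" for k
    using cyc_add_length[of word "i0 + k"] by (simp add: i_def ac_simps)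
  have run: "c (i + j) = c (i + p + j)" if "j < r" for j
    using run0 that shift[of j] shift[of "p + j"] by (simp add: add.assoc)
  have "1 \<le> i" using p by (simp add: i_def)
  show "4 * r \<le> 3 * p"
  proof (cases "p \<le> 22 \<or> r < 18")
    case True
    then show ?thesis
    proof
      assume "p \<le> 22"
      then show ?thesis using short_period_bound[of p r i] p run by simp
    next
      \<comment> \<open>For \<open>p \<ge> 23\<close> the bound is automatic: 4 * 17 = 68 < 69 = 3 *
        23. This ties the window length 18 to the period bound 22.\<close>
      assume "r < 18"
      then show ?thesis
        using short_period_bound[of p r i] p run by (cases "p \<le> 22") auto
    qed
  next
    case False
    obtain d t t' where d: "d \<le> 18" "i + d = start t" "i + p + d = start t'"
      using synchronization[OF \<open>1 \<le> i\<close> p] run False by (metis less_le_trans not_le)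
    have "start t < start t'" "start t' < start (t + length w)"
      using p d by (auto simp: start_period length_word)
    then have t: "t < t'" "t' < t + length w" by (simp_all add: start_less_iff)
    have "\<exists>e. (\<forall>y<e. cyc w (t + y) = cyc w (t' + y)) \<and> r - d \<le> 19 * e"
    proof (rule extend_right[OF t])
      show "c (start t + x) = c (start t' + x)" if "x < r - d" for x
        using run[of "d + x"] that by (simp add: d(2,3)[symmetric] ac_simps)
    qed
    then obtain e where e: "\<forall>y<e. cyc w (t + y) = cyc w (t' + y)" "r - d \<le> 19 * e" by blast
    have "\<exists>e\<le>t. (\<forall>y<e. cyc w (t - Suc y) = cyc w (t' - Suc y)) \<and> d \<le> 19 * e"
    proof (rule extend_left[OF t])
      show "c (start t - Suc x) = c (start t' - Suc x)" if "x < d" for x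
      proof -
        have "d - Suc x < r" using False d(1) that by auto
        then show ?thesis using run[of "d - Suc x"] that by (simp add: d(2,3)[symmetric])
      qed
    qed (use d in simp)
    then obtain e' where e': "e' \<le> t" "\<forall>y<e'. cyc w (t - Suc y) = cyc w (t' - Suc y)" "d \<le> 19 * e'"
      by blast
    \<comment> \<open>The letters on both sides of the boundary join to one run of
      \<open>e' + e\<close> letters at distance \<open>t' - t\<close> in the original word.\<close>
    have "4 * (e' + e) \<le> 3 * (t' - t)"
    proof (rule free[unfolded strongly_free_def, rule_format])
      fix j assume j: "j < e' + e"
      show "cyc w (t - e' + j) = cyc w (t - e' + (t' - t) + j)"
      proof (cases "j < e'")
        case True
        then show ?thesis using e'(1) e'(2)[rule_format, of "e' - Suc j"] t by simp
      next
        case False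
        then show ?thesis using e'(1) e(1)[rule_format, of "j - e'"] t j by simp
      qed
    qed (use t in auto)
    moreover have "r \<le> 19 * (e' + e)" using e(2) e'(3) by simp
    \<comment> \<open>A filler between the copies only enlarges \<open>p\<close>. Altogether
      \<open>4 * r \<le> 76 * (e' + e) \<le> 57 * (t' - t) \<le> 3 * p\<close>.\<close>
    moreover have "19 * (t' - t) \<le> p" using start_add[of t "t' - t"] t d by simp
    ultimately show ?thesis by simp
  qed
qed

lemma length_word_eq: "length word = 19 * (length w - 1) + length B"
proof -
  have "start (Suc k) = length B + 19 * k" if "k < length w" for k
    using that
  proof (induction k)
    case (Suc k)
    then have "\<not> length w dvd Suc k" by (auto dest: dvd_imp_le)
    then show ?case using Suc start_Suc[of "Suc k"] by simp
  qed (simp add: start_def)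
  moreover obtain k where "length w = Suc k" using length_w by (cases "length w") auto
  ultimately show ?thesis by (simp add: length_word)
qed

lemma word_first: "cyc word 0 = L0"
  using c_start[of 0 0] B_first length_B by (simp add: start_def)

end

section \<open>Words of all lengths\<close>

lemma length_letters [simp]: "length (letters s) = length s"
  by (induction s) simp_all

lemma seed_lengths: "map length seeds = [3, 6, 8, 11, 13, 15, 18, 20] @ [23..<132]"
  by (simp add: seeds_def)

lemma filler_lengths: "map length fillers = [18..<75]"
  by (simp add: fillers_def)

lemma exists_seed:
  assumes "m \<in> {3, 6, 8, 11, 13, 15, 18, 20} \<union> {23..<132}"
  shows "\<exists>w. length w = m \<and> strongly_free w \<and> cyc w 0 = L0"
proof -
  have "m \<in> set (map length seeds)" 
    using assms by (auto simp: seed_lengths simp del: upt_rec_numeral)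
  then obtain s where s: "s \<in> set seeds" "length s = m" by auto
  then have "good_seed (letters s)" using seeds_good by (simp add: list_all_iff)
  moreover have "letters s \<noteq> []" using s(2) assms by (cases s) auto
  ultimately show ?thesis
    using s(2) good_seed_strongly_free
    by (intro exI[of _ "letters s"]) (auto simp: good_seed_def cyc_def hd_conv_nth)
qed

lemma exists_insertion:
  assumes "3 \<le> length w" "strongly_free w" "cyc w 0 = L0" "94 \<le> b" "b \<le> 150"
  shows "\<exists>w'. length w' = 19 * (length w - 1) + b \<and> strongly_free w' \<and> cyc w' 0 = L0"
proof -
  \<comment> \<open>The fixed prefix and suffix take 76 letters, which leaves 18 to 74 for the
    middle part.\<close>
  have "b - 76 \<in> set (map length fillers)" 
    using assms by (auto simp: filler_lengths simp del: upt_rec_numeral)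
  then obtain s where s: "s \<in> set fillers" "length s = b - 76" by auto
  interpret filler_insertion w "letters s"
    using assms fillers_good s by unfold_locales (auto simp: list_all_iff)
  show ?thesis
    using length_word_eq length_B s assms strongly_free_word word_first
    by (intro exI[of _ word]) auto
qed

text \<open>One \<open>m\<close> reaches the 57 lengths from \<open>19 * (m - 1) + 94\<close> to
  \<open>19 * (m - 1) + 150\<close>. Since 512 = 19 * 22 + 94, some \<open>m \<ge> 23\<close> works
  from 512 on; the intervals of the eight lengths up to 20 cover 132 to 511.\<close>

lemma length_decomposition:
  fixes n :: nat
  assumes "132 \<le> n"
  shows "\<exists>m b. m \<in> {3, 6, 8, 11, 13, 15, 18, 20} \<union> {23..} \<and> m < n \<and> 94 \<le> b \<and> b \<le> 150 \<and>
    n = 19 * (m - 1) + b"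
proof (cases "512 \<le> n")
  case True
  have "22 \<le> (n - 94) div 19" using True by simp
  moreover have "19 * ((n - 94) div 19) + (n - 94) mod 19 = n - 94" by simp
  moreover have "(n - 94) mod 19 < 19" by simp
  ultimately show ?thesis
    using True by (intro exI[of _ "(n - 94) div 19 + 1"] exI[of _ "94 + (n - 94) mod 19"]) auto
next
  case False
  have decompose: ?thesis
    if "m \<in> {3, 6, 8, 11, 13, 15, 18, 20}" "19 * (m - 1) + 94 \<le> n" "n \<le> 19 * (m - 1) + 150" for m
    using that assms by (intro exI[of _ m] exI[of _ "n - 19 * (m - 1)"]) auto
  consider "n \<le> 188" | "189 \<le> n" "n \<le> 245" | "227 \<le> n" "n \<le> 283" | "284 \<le> n" "n \<le> 340"
    | "322 \<le> n" "n \<le> 378" | "360 \<le> n" "n \<le> 416" | "417 \<le> n" "n \<le> 473" | "455 \<le> n" "n \<le> 511"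
    using False by linarith
  then show ?thesis
    using assms by cases
      (rule decompose[of 3] decompose[of 6] decompose[of 8] decompose[of 11] decompose[of 13]
        decompose[of 15] decompose[of 18] decompose[of 20]; simp; fail)+
qed

lemma exists_strongly_free:
  assumes "m \<in> {3, 6, 8, 11, 13, 15, 18, 20} \<union> {23..}"
  shows "\<exists>w. length w = m \<and> strongly_free w \<and> cyc w 0 = L0"
  using assms
proof (induction m rule: less_induct)
  case (less n)
  show ?case
  proof (cases "n < 132")
    case True
    then show ?thesis using less.prems by (intro exists_seed) auto
  next
    case False
    then obtain m b where m: "m \<in> {3, 6, 8, 11, 13, 15, 18, 20} \<union> {23..}" "m < n"
      "94 \<le> b" "b \<le> 150" "n = 19 * (m - 1) + b"
      using length_decomposition[of n] by (meson not_le)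
    from less.IH[OF m(2,1)] obtain w where "length w = m" "strongly_free w" "cyc w 0 = L0" by blast
    then show ?thesis using exists_insertion[of w b] m by auto
  qed
qed

theorem theorem3p3:
  fixes A :: "'a set" and n :: nat
  assumes "card A = 3" and "n \<ge> 23"
  shows "\<exists>w. set w \<subseteq> A \<and> length w = n \<and> circular_plus_free (7/4) (circular_word w)"
proof -
  obtain x y z where A: "A = {x, y, z}" "x \<noteq> y" "y \<noteq> z" "x \<noteq> z"
    using assms(1) by (auto simp: card_3_iff)
  define g where "g l = (case l of L0 \<Rightarrow> x | L1 \<Rightarrow> y | L2 \<Rightarrow> z)" for l
  have "inj g" using A by (auto intro!: injI simp: g_def split: letter.splits)
  have "n \<in> {3, 6, 8, 11, 13, 15, 18, 20} \<union> {23..}" using assms(2) by simp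
  from exists_strongly_free[OF this] obtain w :: "letter list" where w: "length w = n" "strongly_free w" by blast
  have "set (map g w) \<subseteq> A" by (auto simp: A g_def split: letter.splits)
  then show ?thesis
    using w strongly_free_imp_circular_plus_free[OF strongly_free_map[OF w(2) \<open>inj g\<close>]]
    by (intro exI[of _ "map g w"]) simp
qed

end
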